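(* Let $C\subset\mathbb{R}$ be compact and infinite. Then, for each $n\in\mathbb{N}$, $$L_{n}(C)\geq 2\,(\operatorname{cap} C)^{n},$$ where equality is attained if there exists a polynomial $P_{n}$ of degree $n$ with complex coefficients such that $P_{n}^{-1}([-1,1])=C$.
   Context: Here $\mathbb{N}=\{1,2,3,\ldots\}$. For a compact infinite set $C\subset\mathbb{C}$ and $n\in\mathbb{N}$, the minimum deviation of degree $n$ on $C$ is $$L_n(C):=\min_{c_0,\ldots,c_{n-1}\in\mathbb{C}}\ \max_{z\in C}\Bigl|z^n+\sum_{k=0}^{n-1}c_k z^k\Bigr|.$$ The logarithmic capacity (equivalently Chebyshev constant or transfinite diameter) of $C$ is $\operatorname{cap} C:=\lim_{n\to\infty}\sqrt[n]{L_n(C)}$ (the limit exists by Fekete's theorem). For a polynomial $P_n$ of degree $n$ with complex coefficients, the inverse polynomial image is $P_{n}^{-1}([-1,1]):=\{z\in\mathbb{C}:P_{n}(z)\in[-1,1]\}$, i.e. the full preimage in the complex plane. *)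

theory Defs
  imports "HOL-Analysis.Analysis" "HOL-Computational_Algebra.Polynomial"
begin

text \<open>For compact infinite \<open>C\<close> the supremum and the infimum below are attained, i.e. they are a maximum
  (continuity on a compact set) and a minimum (finite-dimensional best approximation). The definition
  is not meant to be used for other \<open>C\<close>.\<close>

definition min_deviation :: "nat \<Rightarrow> complex set \<Rightarrow> real" where
  "min_deviation n C =
     (INF c::nat \<Rightarrow> complex. SUP z\<in>C. cmod (z ^ n + (\<Sum>k<n. c k * z ^ k)))"

text \<open>The limit exists for compact infinite \<open>C\<close>, by Fekete's theorem.\<close>

definition log_capacity :: "complex set \<Rightarrow> real" where
  "log_capacity C = lim (\<lambda>n. root n (min_deviation n C))"

definition inverse_poly_image :: "complex poly \<Rightarrow> complex set" where
  "inverse_poly_image P = poly P -` (complex_of_real ` {-1..1})"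

end

theory Submission
  imports Defs "HOL-Complex_Analysis.Conformal_Mappings"
    "HOL-Computational_Algebra.Fundamental_Theorem_Algebra"
begin

text \<open>Lower bound: if a monic \<open>q\<close> of degree \<open>n\<close> is real and bounded by \<open>2 b\<close> on \<open>C\<close>, then the
  Dickson (rescaled Chebyshev) polynomial \<open>D\<^sub>k(q)\<close> is monic of degree \<open>n k\<close> and bounded by \<open>2 b ^ k\<close>
  on \<open>C\<close>. Taking \<open>n k\<close>-th roots and \<open>k \<rightarrow> \<infinity>\<close> gives \<open>cap C ^ n \<le> b\<close>.

  Equality: let \<open>C = P\<inverse>[-1,1]\<close> with leading coefficient \<open>a\<close>, and let \<open>Q\<close> be monic of degree \<open>m\<close>.
  Multiplying \<open>Q\<close> over the \<open>n\<close> roots of \<open>P = w\<close> gives, up to sign, \<open>a ^ (-m)\<close> times a monic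
  polynomial of degree \<open>m\<close> in \<open>w\<close>, whose maximum over \<open>[-1,1]\<close> is at least \<open>2 ^ (-m)\<close>. Hence
  \<open>(max\<^sub>C |Q|) ^ n \<ge> (2 |a|) ^ (-m)\<close>, so \<open>cap C ^ n \<ge> 1 / (2 |a|)\<close>, while \<open>P / a\<close> shows that the
  minimum deviation is at most \<open>1 / |a|\<close>.\<close>

subsection \<open>Fekete's lemma\<close>

lemma submultiplicative_power_le:
  fixes L :: "nat \<Rightarrow> real"
  assumes nonneg: "\<And>n. 0 \<le> L n" and submult: "\<And>m n. L (m + n) \<le> L m * L n"
  shows "L (q * m + r) \<le> L m ^ q * L r"
proof (induction q)
  case (Suc q)
  have "L (Suc q * m + r) \<le> L m * L (q * m + r)"
    using submult[of m "q * m + r"] by (simp add: add.assoc)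
  also have "\<dots> \<le> L m * (L m ^ q * L r)"
    by (intro mult_left_mono Suc.IH nonneg)
  finally show ?case by (simp add: mult.assoc)
qed simp

text \<open>The limit is the infimum \<open>c\<close> of the roots. Given \<open>b > c\<close>, some
  \<open>m\<close> has \<open>L m \<le> b ^ m\<close>. Dividing \<open>n\<close> by \<open>m\<close>
  with remainder then bounds \<open>L n\<close> by \<open>b ^ n\<close> times a constant, and the
  n-th root of that constant tends to 1.\<close>

lemma convergent_root_submultiplicative:
  fixes L :: "nat \<Rightarrow> real"
  assumes nonneg: "\<And>n. 0 \<le> L n" and submult: "\<And>m n. L (m + n) \<le> L m * L n"
  shows "convergent (\<lambda>n. root n (L n))"
proof -
  let ?r = "\<lambda>n. root n (L n)"
  \<comment> \<open>The index 0 is left out because \<open>root 0\<close> is constantly 0 and would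
    force the infimum to be 0.\<close>
  define c where "c = (INF n\<in>{1..}. ?r n)"
  have bdd: "bdd_below (?r ` {1..})"
    by (rule bdd_belowI2[of _ 0]) (simp add: nonneg)
  have c_le: "c \<le> ?r n" if "n \<ge> 1" for n
    unfolding c_def by (rule cINF_lower[OF bdd]) (use that in simp)
  have c_nonneg: "0 \<le> c"
    unfolding c_def by (rule cINF_greatest) (auto simp: nonneg)
  have "?r \<longlonglongrightarrow> c"
  proof (rule order_tendstoI)
    fix a assume "a < c"
    then show "\<forall>\<^sub>F n in sequentially. a < ?r n"
      by (intro eventually_sequentiallyI[of 1]) (use c_le in \<open>fastforce intro: less_le_trans\<close>)
  next
    fix a assume "c < a"
    then obtain b where b: "c < b" "b < a" using dense by blast
    have "\<exists>m\<in>{1..}. ?r m < b"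
      using b(1) unfolding c_def by (subst (asm) cINF_less_iff[OF _ bdd]) auto
    then obtain m where m: "m \<ge> 1" "?r m < b" by auto
    have b_pos: "0 < b" using c_nonneg b by linarith
    have "L m = ?r m ^ m" using m nonneg by simp
    also have "\<dots> \<le> b ^ m" using m nonneg by (intro power_mono) auto
    finally have Lm: "L m \<le> b ^ m" .
    \<comment> \<open>The sum dominates \<open>L s / b ^ s\<close> for all remainders
      \<open>s < m\<close> at once; adding 1 keeps \<open>K\<close> positive even if every term
      vanishes, so that \<open>root n K\<close> tends to 1.\<close>
    define K where "K = 1 + (\<Sum>s<m. L s / b ^ s)"
    have K_pos: "0 < K"
      unfolding K_def using nonneg b_pos by (intro add_pos_nonneg sum_nonneg) auto
    have L_le: "L n \<le> b ^ n * K" for n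
    proof -
      let ?s = "n mod m"
      have "L ?s / b ^ ?s \<le> (\<Sum>s<m. L s / b ^ s)"
        using m nonneg b_pos by (intro member_le_sum) auto
      then have "L ?s / b ^ ?s \<le> K" by (simp add: K_def)
      then have "L ?s \<le> b ^ ?s * K"
        using zero_less_power[OF b_pos, of ?s] by (simp add: field_simps)
      have "L n \<le> L m ^ (n div m) * L ?s"
        using submultiplicative_power_le[OF assms, of "n div m" m ?s] by simp
      also have "\<dots> \<le> (b ^ m) ^ (n div m) * (b ^ ?s * K)"
        using Lm \<open>L ?s \<le> b ^ ?s * K\<close> nonneg b_pos by (intro mult_mono power_mono) auto
      also have "\<dots> = b ^ n * K"
        by (simp flip: power_mult power_add mult.assoc)
      finally show ?thesis .
    qed
    have "(\<lambda>n. b * root n K) \<longlonglongrightarrow> b * 1"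
      by (intro tendsto_intros LIMSEQ_root_const K_pos)
    then have "\<forall>\<^sub>F n in sequentially. b * root n K < a"
      using b by (intro order_tendstoD) auto
    then show "\<forall>\<^sub>F n in sequentially. ?r n < a"
      using eventually_ge_at_top[of 1]
    proof eventually_elim
      case (elim n)
      have "?r n \<le> root n (b ^ n * K)"
        using elim L_le by (intro real_root_le_mono) auto
      also have "\<dots> = b * root n K"
        using elim b_pos by (simp add: real_root_mult real_root_power_cancel)
      finally show ?case using elim by simp
    qed
  qed
  then show ?thesis by (rule convergentI)
qed

subsection \<open>Minimum deviation and monic polynomials\<close>

text \<open>This and the next lemma pass between the coefficient functions in
  \<open>min_deviation\<close> and monic polynomials.\<close>

lemma poly_monic_altdef:
  fixes p :: "'a::comm_ring_1 poly"
  assumes "degree p = n" "lead_coeff p = 1"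
  shows "poly p z = z ^ n + (\<Sum>k<n. coeff p k * z ^ k)"
  using assms by (simp add: poly_altdef flip: lessThan_Suc_atMost)

lemma monic_poly_of_coeffs:
  fixes c :: "nat \<Rightarrow> 'a::comm_ring_1"
  obtains p where "degree p = n" "lead_coeff p = 1"
    "\<And>z. poly p z = z ^ n + (\<Sum>k<n. c k * z ^ k)"
proof -
  define p where "p = monom 1 n + (\<Sum>k<n. monom (c k) k)"
  have coeff: "coeff p j = (if j = n then 1 else if j < n then c j else 0)" for j
    by (auto simp: p_def coeff_sum)
  have "degree p = n"
    by (intro antisym degree_le le_degree) (auto simp: coeff)
  then show ?thesis
    by (intro that[of p]) (simp_all add: coeff, simp add: p_def poly_monom poly_sum)
qed

text \<open>These are the side conditions that make the real \<open>SUP\<close> and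
  \<open>INF\<close> in \<open>min_deviation\<close> meaningful: continuity on a compact set bounds
  the former, and 0 bounds the latter from below.\<close>

lemma
  assumes "compact C" "C \<noteq> {}"
  shows bdd_above_deviation:
      "bdd_above ((\<lambda>z. cmod (z ^ n + (\<Sum>k<n. c k * z ^ k))) ` C)"
    and deviation_nonneg: "0 \<le> (SUP z\<in>C. cmod (z ^ n + (\<Sum>k<n. c k * z ^ k)))"
proof -
  show bdd: "bdd_above ((\<lambda>z. cmod (z ^ n + (\<Sum>k<n. c k * z ^ k))) ` C)"
    by (intro bounded_imp_bdd_above compact_imp_bounded compact_continuous_image
        continuous_intros assms)
  obtain z where "z \<in> C" using assms by blast
  then show "0 \<le> (SUP z\<in>C. cmod (z ^ n + (\<Sum>k<n. c k * z ^ k)))"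
    by (intro cSUP_upper2[OF bdd]) auto
qed

lemma min_deviation_nonneg:
  assumes "compact C" "C \<noteq> {}"
  shows "0 \<le> min_deviation n C"
  unfolding min_deviation_def by (intro cINF_greatest deviation_nonneg assms) auto

lemma min_deviation_le:
  assumes "compact C" "C \<noteq> {}" and p: "degree p = n" "lead_coeff p = 1"
    and le: "\<And>z. z \<in> C \<Longrightarrow> cmod (poly p z) \<le> B"
  shows "min_deviation n C \<le> B"
proof -
  have "bdd_below (range (\<lambda>c. SUP z\<in>C. cmod (z ^ n + (\<Sum>k<n. c k * z ^ k))))"
    by (rule bdd_belowI2[of _ 0]) (rule deviation_nonneg[OF assms(1,2)])
  then have "min_deviation n C \<le> (SUP z\<in>C. cmod (z ^ n + (\<Sum>k<n. coeff p k * z ^ k)))"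
    unfolding min_deviation_def by (rule cINF_lower) simp
  also have "\<dots> \<le> B"
    using assms(2) le by (intro cSUP_least) (auto simp: poly_monic_altdef[OF p])
  finally show ?thesis .
qed

text \<open>Near-minimisers serve in place of minimisers; later proofs let \<open>B\<close> decrease
  to the infimum.\<close>

lemma min_deviation_lessE:
  assumes "compact C" "C \<noteq> {}" "min_deviation n C < B"
  obtains p where "degree p = n" "lead_coeff p = 1" "\<And>z. z \<in> C \<Longrightarrow> cmod (poly p z) < B"
proof -
  have "bdd_below (range (\<lambda>c. SUP z\<in>C. cmod (z ^ n + (\<Sum>k<n. c k * z ^ k))))"
    by (rule bdd_belowI2[of _ 0]) (rule deviation_nonneg[OF assms(1,2)])
  then obtain c where c: "(SUP z\<in>C. cmod (z ^ n + (\<Sum>k<n. c k * z ^ k))) < B"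
    using assms(3) unfolding min_deviation_def by (subst (asm) cINF_less_iff) auto
  obtain p where "degree p = n" "lead_coeff p = 1"
    and p: "\<And>z. poly p z = z ^ n + (\<Sum>k<n. c k * z ^ k)"
    using monic_poly_of_coeffs[of n c] by blast
  moreover have "cmod (poly p z) < B" if "z \<in> C" for z
    unfolding p using cSUP_upper[OF that bdd_above_deviation[OF assms(1,2)]] c
    by (rule le_less_trans)
  ultimately show ?thesis using that by blast
qed

text \<open>The product of near-minimisers of degrees \<open>m\<close> and \<open>n\<close> is a
  monic competitor of degree \<open>m + n\<close>. The slack \<open>e\<close> then tends to 0 from
  the right.\<close>

lemma min_deviation_submult:
  assumes C: "compact C" "C \<noteq> {}"
  shows "min_deviation (m + n) C \<le> min_deviation m C * min_deviation n C"
proof -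
  let ?L = "\<lambda>n. min_deviation n C"
  have "?L (m + n) \<le> (?L m + e) * (?L n + e)" if e: "e > 0" for e
  proof -
    obtain p where p: "degree p = m" "lead_coeff p = 1"
      "\<And>z. z \<in> C \<Longrightarrow> cmod (poly p z) < ?L m + e"
      using min_deviation_lessE[OF C, of m "?L m + e"] e by auto
    obtain q where q: "degree q = n" "lead_coeff q = 1"
      "\<And>z. z \<in> C \<Longrightarrow> cmod (poly q z) < ?L n + e"
      using min_deviation_lessE[OF C, of n "?L n + e"] e by auto
    show ?thesis
    proof (rule min_deviation_le[OF C])
      have "p \<noteq> 0" "q \<noteq> 0" using p q by auto
      then show "degree (p * q) = m + n" using p q by (simp add: degree_mult_eq)
      show "lead_coeff (p * q) = 1" using p q by (simp add: lead_coeff_mult)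
      fix z assume "z \<in> C"
      then show "cmod (poly (p * q) z) \<le> (?L m + e) * (?L n + e)"
        using p(3) q(3) min_deviation_nonneg[OF C] e
        by (simp add: norm_mult) (intro mult_mono; force intro: less_imp_le)
    qed
  qed
  then have "\<forall>\<^sub>F e in at_right 0. ?L (m + n) \<le> (?L m + e) * (?L n + e)"
    by (intro eventually_at_rightI[of 0 1]) auto
  moreover have "((\<lambda>e. (?L m + e) * (?L n + e)) \<longlongrightarrow> (?L m + 0) * (?L n + 0)) (at_right 0)"
    by (intro tendsto_intros)
  ultimately show ?thesis
    using tendsto_lowerbound[OF _ _ trivial_limit_at_right_real] by force
qed

text \<open>Submultiplicativity and Fekete's lemma give convergence, so the \<open>lim\<close> in
  the definition is a genuine limit.\<close>

lemma log_capacity_tendsto: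
  assumes "compact C" "C \<noteq> {}"
  shows "(\<lambda>n. root n (min_deviation n C)) \<longlonglongrightarrow> log_capacity C"
  unfolding log_capacity_def
  using convergent_root_submultiplicative[of "\<lambda>n. min_deviation n C"]
    min_deviation_nonneg[OF assms] min_deviation_submult[OF assms]
  by (simp add: convergent_LIMSEQ_iff)

subsection \<open>Dickson polynomials\<close>

text \<open>The Dickson polynomial of the first kind; for \<open>a = 1\<close> it equals 2 T_k(x /
  2) with T_k the Chebyshev polynomial. Since the ring is arbitrary, \<open>x\<close> may itself be
  a polynomial, and \<open>dickson q [:a:] k\<close> is then the composition with
  \<open>q\<close>.\<close>

fun dickson :: "'a::comm_ring_1 \<Rightarrow> 'a \<Rightarrow> nat \<Rightarrow> 'a" where
  "dickson x a 0 = 2"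
| "dickson x a (Suc 0) = x"
| "dickson x a (Suc (Suc k)) = x * dickson x a (Suc k) - a * dickson x a k"

lemma poly_dickson: "poly (dickson p q k) z = dickson (poly p z) (poly q z) k"
  by (induction p q k rule: dickson.induct) auto

lemma dickson_of_real: "dickson (of_real x) (of_real a) k = of_real (dickson x a k)"
  by (induction x a k rule: dickson.induct) auto

text \<open>With \<open>x = 2 * b * cos t\<close> the recurrence becomes the product-to-sum formula
  for cosines, scaled by powers of \<open>b\<close>.\<close>

lemma dickson_cos: "dickson (2 * b * cos t) (b\<^sup>2) k = 2 * b ^ k * cos (real k * t)"
proof (induction "2 * b * cos t" "b\<^sup>2" k rule: dickson.induct)
  case (3 k)
  have "cos (real (Suc (Suc k)) * t) + cos (real k * t) = 2 * cos t * cos (real (Suc k) * t)"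
    using cos_add[of "real (Suc k) * t" t] cos_diff[of "real (Suc k) * t" t]
    by (simp add: algebra_simps)
  then have "cos (real (Suc (Suc k)) * t) = 2 * cos t * cos (real (Suc k) * t) - cos (real k * t)"
    by linarith
  note cos_rec = this
  have "dickson (2 * b * cos t) (b\<^sup>2) (Suc (Suc k)) =
      2 * b * cos t * (2 * b ^ Suc k * cos (real (Suc k) * t)) - b\<^sup>2 * (2 * b ^ k * cos (real k * t))"
    using 3 by simp
  also have "\<dots> =
      2 * b ^ Suc (Suc k) * (2 * cos t * cos (real (Suc k) * t) - cos (real k * t))"
    by (simp add: algebra_simps power2_eq_square)
  finally show ?case by (simp only: cos_rec)
qed auto

lemma abs_dickson_le:
  fixes x b :: real
  assumes "\<bar>x\<bar> \<le> 2 * b" "b > 0"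
  shows "\<bar>dickson x (b\<^sup>2) k\<bar> \<le> 2 * b ^ k"
proof -
  define t where "t = arccos (x / (2 * b))"
  have "x = 2 * b * cos t"
    using assms by (simp add: t_def field_simps abs_le_iff cos_arccos)
  then show ?thesis
    using assms by (simp add: dickson_cos abs_mult mult_left_le)
qed

text \<open>The leading term comes from \<open>q\<close> times the preceding polynomial, as the
  subtracted term has smaller degree. The index is \<open>Suc k\<close> because index 0 gives the
  constant 2, which is not monic.\<close>

lemma dickson_monic:
  fixes q :: "'a::idom poly"
  assumes q: "degree q = n" "lead_coeff q = 1" "n \<ge> 1"
  shows "degree (dickson q [:a:] (Suc k)) = n * Suc k \<and> lead_coeff (dickson q [:a:] (Suc k)) = 1"
proof (induction k rule: less_induct)
  case (less k)
  show ?case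
  proof (cases k)
    case 0
    then show ?thesis using q by simp
  next
    case (Suc j)
    let ?u = "q * dickson q [:a:] (Suc j)" and ?v = "[:a:] * dickson q [:a:] j"
    have IH: "degree (dickson q [:a:] (Suc j)) = n * Suc j" "lead_coeff (dickson q [:a:] (Suc j)) = 1"
      using less.IH[of j] Suc by auto
    have "q \<noteq> 0" "dickson q [:a:] (Suc j) \<noteq> 0" using q IH by auto
    then have u: "degree ?u = n * Suc (Suc j)" "lead_coeff ?u = 1"
      using q IH by (simp add: degree_mult_eq, simp only: lead_coeff_mult mult_1)
    have "degree (dickson q [:a:] j) \<le> n * j"
      using less.IH[of "j - 1"] Suc by (cases j) auto
    then have "degree (- ?v) < degree ?u"
      unfolding u degree_minus using degree_smult_le[of a "dickson q [:a:] j"] q by simp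
    then have "degree (- ?v + ?u) = degree ?u" "lead_coeff (- ?v + ?u) = lead_coeff ?u"
      by (rule degree_add_eq_right, rule lead_coeff_add_le)
    moreover have "dickson q [:a:] (Suc k) = - ?v + ?u" using Suc by simp
    ultimately show ?thesis using u Suc by metis
  qed
qed

subsection \<open>The lower bound\<close>

text \<open>At real arguments, taking real parts of the coefficients takes the real part of the
  value. This cannot increase the modulus, and it yields the real values that the cosine
  parametrisation of Dickson polynomials requires.\<close>

lemma monic_Re_poly:
  assumes "degree p = n" "lead_coeff p = 1"
  obtains q where "degree q = n" "lead_coeff q = 1"
    "\<And>z. z \<in> \<real> \<Longrightarrow> poly q z = complex_of_real (Re (poly p z))"
proof -
  obtain q :: "complex poly" where "degree q = n" "lead_coeff q = 1"
    and q: "\<And>z. poly q z = z ^ n + (\<Sum>k<n. of_real (Re (coeff p k)) * z ^ k)"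
    using monic_poly_of_coeffs[of n "\<lambda>k. of_real (Re (coeff p k))"] by blast
  moreover have "poly q z = of_real (Re (poly p z))" if "z \<in> \<real>" for z
    using that unfolding q poly_monic_altdef[OF assms]
    by (elim Reals_cases) (simp flip: of_real_power)
  ultimately show ?thesis using that by blast
qed

lemma min_deviation_mult_le:
  assumes C: "compact C" "C \<noteq> {}" "C \<subseteq> \<real>" and "n \<ge> 1" "k \<ge> 1"
    and less: "min_deviation n C < 2 * b"
  shows "min_deviation (n * k) C \<le> 2 * b ^ k"
proof -
  obtain p where p: "degree p = n" "lead_coeff p = 1" "\<And>z. z \<in> C \<Longrightarrow> cmod (poly p z) < 2 * b"
    using min_deviation_lessE[OF C(1,2) less] by blast
  obtain q where q: "degree q = n" "lead_coeff q = 1"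
    "\<And>z. z \<in> \<real> \<Longrightarrow> poly q z = complex_of_real (Re (poly p z))"
    using monic_Re_poly[OF p(1,2)] by blast
  have b: "b > 0" using less min_deviation_nonneg[OF C(1,2), of n] by simp
  let ?D = "dickson q [:complex_of_real (b\<^sup>2):] k"
  show ?thesis
  proof (rule min_deviation_le[OF C(1,2)])
    show "degree ?D = n * k" "lead_coeff ?D = 1"
      using dickson_monic[OF q(1,2) \<open>n \<ge> 1\<close>, of "complex_of_real (b\<^sup>2)" "k - 1"] \<open>k \<ge> 1\<close>
      by (auto simp del: of_real_power)
    fix z assume z: "z \<in> C"
    then have "poly ?D z = of_real (dickson (Re (poly p z)) (b\<^sup>2) k)"
      using q(3) C(3) by (simp add: poly_dickson dickson_of_real subset_iff del: of_real_power)
    moreover have "\<bar>Re (poly p z)\<bar> \<le> 2 * b"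
      using abs_Re_le_cmod[of "poly p z"] p(3)[OF z] by linarith
    ultimately show "cmod (poly ?D z) \<le> 2 * b ^ k"
      using abs_dickson_le b by simp
  qed
qed

lemma log_capacity_nonneg:
  assumes "compact C" "C \<noteq> {}"
  shows "0 \<le> log_capacity C"
  using log_capacity_tendsto[OF assms]
  by (rule LIMSEQ_le_const) (simp add: min_deviation_nonneg[OF assms] real_root_ge_zero)

lemma log_capacity_power_le:
  assumes C: "compact C" "C \<noteq> {}" "C \<subseteq> \<real>" and n: "n \<ge> 1"
  shows "2 * log_capacity C ^ n \<le> min_deviation n C"
proof (rule dense_ge)
  \<comment> \<open>A bound strictly above the deviation leaves room for a near-minimiser;
    \<open>M / 2\<close> takes the role of \<open>b\<close>.\<close>
  fix M assume M: "min_deviation n C < M"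
  then have M_pos: "M > 0" using min_deviation_nonneg[OF C(1,2), of n] by linarith
  let ?r = "\<lambda>m. root m (min_deviation m C)"
  \<comment> \<open>The capacity is also the limit along the multiples of \<open>n\<close>, which
    are the degrees of the Dickson polynomials in \<open>q\<close>.\<close>
  have "strict_mono (\<lambda>k. n * k)" using n by (intro strict_monoI) simp
  from LIMSEQ_subseq_LIMSEQ[OF log_capacity_tendsto[OF C(1,2)] this]
  have "(\<lambda>k. ?r (n * k) ^ n) \<longlonglongrightarrow> log_capacity C ^ n"
    by (intro tendsto_intros) (simp add: o_def)
  moreover have "(\<lambda>k. root k 2 * (M / 2)) \<longlonglongrightarrow> 1 * (M / 2)"
    by (intro tendsto_intros LIMSEQ_root_const) simp
  moreover have "?r (n * k) ^ n \<le> root k 2 * (M / 2)" if "k \<ge> 1" for k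
  proof -
    have "?r (n * k) ^ n = root k (min_deviation (n * k) C)"
      using n min_deviation_nonneg[OF C(1,2)] by (simp add: real_root_mult_exp real_root_ge_zero)
    also have "\<dots> \<le> root k (2 * (M / 2) ^ k)"
      using that min_deviation_mult_le[OF C n that, of "M / 2"] M
      by (intro real_root_le_mono) auto
    also have "\<dots> = root k 2 * (M / 2)"
      using that M_pos by (simp add: real_root_mult real_root_power_cancel)
    finally show ?thesis .
  qed
  ultimately have "log_capacity C ^ n \<le> 1 * (M / 2)"
    using LIMSEQ_le by blast
  then show "2 * log_capacity C ^ n \<le> M" by simp
qed

subsection \<open>Inverse polynomial images\<close>

lemma poly_eq_prod_proots:
  "poly p z = lead_coeff p * (\<Prod>x\<in>#proots p. z - x)" for p :: "complex poly"
  by (subst complex_poly_decompose_multiset[of p, symmetric]) (simp add: poly_prod_mset)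

lemma norm_prod_mset_image:
  "norm (\<Prod>x\<in>#A. f x) = (\<Prod>x\<in>#A. norm (f x))" for f :: "_ \<Rightarrow> 'a::real_normed_field"
  by (induction A) (auto simp: norm_mult)

lemma prod_mset_image_le_power:
  fixes f :: "'a \<Rightarrow> real"
  assumes "\<And>x. x \<in># A \<Longrightarrow> 0 \<le> f x \<and> f x \<le> B"
  shows "0 \<le> (\<Prod>x\<in>#A. f x) \<and> (\<Prod>x\<in>#A. f x) \<le> B ^ size A"
  using assms by (induction A) (auto intro!: mult_mono intro: order_trans)

lemma
  fixes p :: "'a::ab_group_add poly"
  assumes "degree p \<ge> 1"
  shows degree_minus_const: "degree (p - [:w:]) = degree p"
    and lead_coeff_minus_const: "lead_coeff (p - [:w:]) = lead_coeff p"
proof -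
  have "degree (- [:w:]) < degree p" using assms by simp
  from degree_add_eq_right[OF this] lead_coeff_add_le[OF this]
  show "degree (p - [:w:]) = degree p" "lead_coeff (p - [:w:]) = lead_coeff p"
    by (simp_all only: uminus_add_conv_diff)
qed

text \<open>Both sides are, up to sign, the resultant of \<open>P - w\<close> and \<open>Q\<close>.\<close>

lemma norm_prod_over_fibre:
  fixes P Q :: "complex poly"
  assumes P: "degree P \<ge> 1" and Q: "lead_coeff Q = 1"
  shows "cmod (lead_coeff P) ^ degree Q * cmod (\<Prod>z\<in>#proots (P - [:w:]). poly Q z)
       = cmod (\<Prod>x\<in>#proots Q. w - poly P x)"
proof -
  let ?F = "proots (P - [:w:])"
  \<comment> \<open>Factor \<open>P - [:w:]\<close>, whose leading coefficient is that of
    \<open>P\<close>, over its roots and evaluate at \<open>x\<close>.\<close>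
  have fibre: "cmod (lead_coeff P) * cmod (\<Prod>z\<in>#?F. z - x) = cmod (w - poly P x)" for x
  proof -
    have "cmod (w - poly P x) = cmod (poly (P - [:w:]) x)"
      by (simp add: norm_minus_commute)
    also have "\<dots> = cmod (lead_coeff P) * (\<Prod>z\<in>#?F. cmod (x - z))"
      using lead_coeff_minus_const[of P w] P
      by (simp only: poly_eq_prod_proots norm_mult norm_prod_mset_image)
    finally show ?thesis
      by (simp add: norm_prod_mset_image norm_minus_commute)
  qed
  \<comment> \<open>Splitting \<open>Q\<close> over its own roots gives a double product. After
    swapping, each root of \<open>Q\<close> contributes one instance of \<open>fibre\<close>, which
    absorbs one factor \<open>cmod (lead_coeff P)\<close>.\<close>
  have "(\<Prod>z\<in>#?F. poly Q z) = (\<Prod>z\<in>#?F. \<Prod>x\<in>#proots Q. z - x)"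
    by (subst poly_eq_prod_proots) (simp add: Q)
  also have "\<dots> = (\<Prod>x\<in>#proots Q. \<Prod>z\<in>#?F. z - x)"
    by (rule prod_mset.swap)
  finally have "cmod (lead_coeff P) ^ degree Q * cmod (\<Prod>z\<in>#?F. poly Q z)
      = (\<Prod>x\<in>#proots Q. cmod (lead_coeff P) * cmod (\<Prod>z\<in>#?F. z - x))"
    by (simp add: norm_prod_mset_image prod_mset.distrib size_proots_complex)
  also have "\<dots> = (\<Prod>x\<in>#proots Q. cmod (w - poly P x))"
    by (simp only: fibre)
  finally show ?thesis by (simp only: norm_prod_mset_image)
qed

text \<open>With \<open>w = Re u\<close> for \<open>cmod u = 1\<close> we have \<open>u * (w - b) = (u\<^sup>2 + 1) / 2 - u * b\<close>, which is a
  polynomial in \<open>u\<close> with value \<open>1 / 2\<close> at \<open>0\<close>: the maximum modulus principle applies.\<close>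

lemma half_power_le_bound:
  fixes f :: "'a \<Rightarrow> complex"
  assumes le: "\<And>w. w \<in> {-1..1} \<Longrightarrow> cmod (\<Prod>x\<in>#A. of_real w - f x) \<le> M"
  shows "(1 / 2) ^ size A \<le> M"
proof -
  define g where "g = (\<Prod>x\<in>#A. [:1 / 2, - f x, 1 / 2:])"
  have "cmod (poly g 0) \<le> M"
  proof (rule maximum_modulus_frontier[of "poly g" "cball 0 1"])
    fix u :: complex assume "u \<in> frontier (cball 0 1)"
    then have u: "cmod u = 1" by (simp add: dist_norm)
    have "u * cnj u = 1" by (simp add: complex_norm_square[symmetric] u)
    moreover have Re_eq: "of_real (Re u) = (u + cnj u) / 2" by (simp add: complex_eq_iff)
    ultimately have Re_u: "u * of_real (Re u) = (u * u + 1) / 2"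
      by (simp add: Re_eq distrib_left)
    have "poly [:1 / 2, - b, 1 / 2:] u = u * (of_real (Re u) - b)" for b
      unfolding right_diff_distrib Re_u by (simp add: algebra_simps add_divide_distrib)
    then have "cmod (poly [:1 / 2, - f x, 1 / 2:] u) = cmod (of_real (Re u) - f x)" for x
      using u by (simp only: norm_mult mult_1)
    then have "cmod (poly g u) = cmod (\<Prod>x\<in>#A. of_real (Re u) - f x)"
      by (simp only: g_def poly_prod_mset norm_prod_mset_image)
    moreover have "Re u \<in> {-1..1}" using abs_Re_le_cmod[of u] u by auto
    ultimately show "cmod (poly g u) \<le> M" using le by simp
  qed (auto intro!: holomorphic_intros continuous_intros)
  moreover have "poly g 0 = (1 / 2) ^ size A"
    by (simp add: g_def poly_prod_mset)
  ultimately show ?thesis by (simp add: norm_power norm_divide)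
qed

lemma min_deviation_inverse_image_ge:
  assumes C: "compact C" "C \<noteq> {}" and P: "degree P = n" "n \<ge> 1" "inverse_poly_image P = C"
  shows "(1 / (2 * cmod (lead_coeff P))) ^ m \<le> min_deviation m C ^ n"
proof -
  let ?a = "cmod (lead_coeff P)"
  have a: "?a > 0" using P by auto
  have bound: "(1 / (2 * ?a)) ^ m \<le> B ^ n" if less: "min_deviation m C < B" for B
  proof -
    obtain Q where Q: "degree Q = m" "lead_coeff Q = 1" "\<And>z. z \<in> C \<Longrightarrow> cmod (poly Q z) < B"
      using min_deviation_lessE[OF C less] by blast
    have "(1 / 2) ^ size (proots Q) \<le> ?a ^ m * B ^ n"
    proof (rule half_power_le_bound)
      fix w :: real assume w: "w \<in> {-1..1}"
      let ?R = "P - [:of_real w:]"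
      have deg: "degree ?R = n"
        using P by (simp add: degree_minus_const)
      then have "?R \<noteq> 0" using P by auto
      \<comment> \<open>As \<open>w\<close> lies in [-1,1], the whole fibre lies in
        \<open>C\<close>, where \<open>Q\<close> is bounded by \<open>B\<close>; counted with
        multiplicity it has \<open>n\<close> points.\<close>
      then have "set_mset (proots ?R) = {z. poly ?R z = 0}" by (rule set_count_proots)
      also have "\<dots> \<subseteq> C" using w P(3) by (auto simp: inverse_poly_image_def)
      finally have "cmod (\<Prod>z\<in>#proots ?R. poly Q z) \<le> B ^ size (proots ?R)"
        unfolding norm_prod_mset_image
        by (intro conjunct2[OF prod_mset_image_le_power]) (use Q(3) in \<open>auto intro: less_imp_le\<close>)
      then have "?a ^ m * cmod (\<Prod>z\<in>#proots ?R. poly Q z) \<le> ?a ^ m * B ^ n"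
        by (intro mult_left_mono) (simp_all add: size_proots_complex deg)
      then show "cmod (\<Prod>x\<in>#proots Q. of_real w - poly P x) \<le> ?a ^ m * B ^ n"
        using norm_prod_over_fibre[of P Q "of_real w"] P Q by simp
    qed
    then show ?thesis
      using a by (simp add: size_proots_complex Q power_divide power_mult_distrib field_simps)
  qed
  let ?L = "min_deviation m C"
  have "\<forall>\<^sub>F B in at_right ?L. (1 / (2 * ?a)) ^ m \<le> B ^ n"
    by (intro eventually_at_rightI[of _ "?L + 1"]) (auto intro: bound)
  moreover have "((\<lambda>B. B ^ n) \<longlongrightarrow> ?L ^ n) (at_right ?L)"
    by (intro tendsto_intros)
  ultimately show ?thesis
    using tendsto_lowerbound[OF _ _ trivial_limit_at_right_real] by blast
qed

lemma log_capacity_inverse_image_ge: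
  assumes C: "compact C" "C \<noteq> {}" and P: "degree P = n" "n \<ge> 1" "inverse_poly_image P = C"
  shows "1 / (2 * cmod (lead_coeff P)) \<le> log_capacity C ^ n"
proof (rule LIMSEQ_le_const)
  let ?b = "1 / (2 * cmod (lead_coeff P))"
  let ?r = "\<lambda>m. root m (min_deviation m C)"
  show "(\<lambda>m. ?r m ^ n) \<longlonglongrightarrow> log_capacity C ^ n"
    by (intro tendsto_intros log_capacity_tendsto C)
  have "?b \<le> ?r m ^ n" if m: "m \<ge> 1" for m
  \<comment> \<open>Comparing m-th powers removes the root; \<open>Suc (m - 1)\<close> is
    \<open>m\<close> in the shape the rule expects.\<close>
  proof (rule power_le_imp_le_base)
    have "?b ^ m \<le> (?r m ^ m) ^ n"
      using min_deviation_inverse_image_ge[OF assms, of m] m min_deviation_nonneg[OF C, of m]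
      by simp
    then show "?b ^ Suc (m - 1) \<le> (?r m ^ n) ^ Suc (m - 1)"
      using m by (simp add: power_mult[symmetric] mult.commute)
  qed (simp add: min_deviation_nonneg[OF C] real_root_ge_zero)
  then show "\<exists>N. \<forall>m\<ge>N. ?b \<le> ?r m ^ n" by blast
qed

lemma min_deviation_inverse_image_le:
  assumes C: "compact C" "C \<noteq> {}" and P: "degree P = n" "n \<ge> 1" "inverse_poly_image P = C"
  shows "min_deviation n C \<le> 1 / cmod (lead_coeff P)"
proof (rule min_deviation_le[OF C])
  let ?a = "lead_coeff P"
  have a: "?a \<noteq> 0" using P by auto
  then show "degree (smult (1 / ?a) P) = n" "lead_coeff (smult (1 / ?a) P) = 1"
    using P by simp_all
  fix z assume "z \<in> C"
  then have "cmod (poly P z) \<le> 1"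
    using P(3) by (auto simp: inverse_poly_image_def)
  then show "cmod (poly (smult (1 / ?a) P) z) \<le> 1 / cmod ?a"
    using a by (simp add: norm_mult norm_divide divide_right_mono)
qed

theorem theorem2:
  fixes C :: "complex set" and n :: nat
  assumes "compact C" and "infinite C" and "C \<subseteq> \<real>" and "n \<ge> 1"
  shows "min_deviation n C \<ge> 2 * log_capacity C ^ n \<and>
         ((\<exists>P :: complex poly. degree P = n \<and> inverse_poly_image P = C) \<longrightarrow>
            min_deviation n C = 2 * log_capacity C ^ n)"
proof (intro conjI impI)
  have ne: "C \<noteq> {}" using assms by auto
  show ge: "min_deviation n C \<ge> 2 * log_capacity C ^ n"
    by (rule log_capacity_power_le[OF assms(1) ne assms(3,4)])
  assume "\<exists>P :: complex poly. degree P = n \<and> inverse_poly_image P = C"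
  then obtain P :: "complex poly" where P: "degree P = n" "inverse_poly_image P = C" by blast
  \<comment> \<open>With \<open>a\<close> the leading coefficient of \<open>P\<close>, the deviation
    is at most 1 / |a|, which is twice 1 / (2 |a|) and hence at most
    \<open>2 * log_capacity C ^ n\<close>; \<open>ge\<close> is the converse.\<close>
  show "min_deviation n C = 2 * log_capacity C ^ n"
    using min_deviation_inverse_image_le[OF assms(1) ne P(1) assms(4) P(2)]
      log_capacity_inverse_image_ge[OF assms(1) ne P(1) assms(4) P(2)] ge
    by simp
qed

end
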